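(* Let $k\ge1$ and let $r_k(n)=\mathrm{mp}_C(n,k)$ for $n\ge1$, with $r_k(0)=1$. Then for all $n\ge0$, \[ r_k(n+1)=\sum_{\substack{0\le j\le n\\ k\mid j}} r_k(j)\,r_k(n-j). \]
   Context: A subexcedant function on $[n]$ is a map $f:[n]\to[n]$ with $1\le f(i)\le i$. For such $f$ let $\varphi(f) = (n\ f(n)) \circ \dots \circ (2\ f(2)) \circ (1\ f(1))$, where $(a\ b)$ is the transposition swapping $a,b$ (identity if $a=b$) and $\circ$ is composition; $\varphi$ is a bijection onto permutations of $[n]$, and $f_\pi:=\varphi^{-1}(\pi)$. A word $w_1\cdots w_n$ is a Catalan word if $w_1=1$ and $1\le w_i\le w_{i-1}+1$ for $2\le i\le n$. A permutation $\pi$ of $[n]$ is mod-$k$-alternating if $\pi(i)\equiv i\pmod k$ for all $i$. $\mathrm{mp}_C(n,k)$ is the number of mod-$k$-alternating permutations $\pi$ of $[n]$ with $f_\pi(1)\cdots f_\pi(n)$ a Catalan word. *)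

theory Defs
  imports "HOL-Library.FuncSet" "HOL-Combinatorics.Permutations" "HOL-Number_Theory.Cong"
begin

text \<open>
  Functions on \<open>[n] = {1..n}\<close> live in the type \<open>nat \<Rightarrow> nat\<close>. Subexcedant functions take the
  value \<open>undefined\<close> outside \<open>[n]\<close>, so that each is represented once; permutations of \<open>[n]\<close>
  are the identity outside \<open>[n]\<close>, as usual for \<open>permutes\<close>.
\<close>

definition subexcedant :: "nat \<Rightarrow> (nat \<Rightarrow> nat) set" where
  "subexcedant n = (\<Pi>\<^sub>E i\<in>{1..n}. {1..i})"

fun phi :: "nat \<Rightarrow> (nat \<Rightarrow> nat) \<Rightarrow> (nat \<Rightarrow> nat)" where
  "phi 0 f = id"
| "phi (Suc n) f = Transposition.transpose (Suc n) (f (Suc n)) \<circ> phi n f"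

lemma phi_cong: "(\<And>i. i \<in> {1..n} \<Longrightarrow> f i = g i) \<Longrightarrow> phi n f = phi n g"
  by (induction n) auto

lemma phi_permutes:
  "(\<And>i. i \<in> {1..n} \<Longrightarrow> f i \<in> {1..i}) \<Longrightarrow> phi n f permutes {1..n}"
proof (induction n)
  case (Suc n)
  have "phi n f permutes {1..n}"
    using Suc by simp
  then have "phi n f permutes {1..Suc n}"
    by (rule permutes_subset) auto
  moreover have "Transposition.transpose (Suc n) (f (Suc n)) permutes {1..Suc n}"
    using Suc.prems[of "Suc n"] by (intro permutes_swap_id) auto
  ultimately show ?case
    unfolding phi.simps by (intro permutes_compose)
qed (simp add: permutes_def)

lemma phi_Suc_top:
  assumes "\<And>i. i \<in> {1..n} \<Longrightarrow> f i \<in> {1..i}"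
  shows "phi (Suc n) f (Suc n) = f (Suc n)"
proof -
  have "phi n f (Suc n) = Suc n"
    using permutes_not_in[OF phi_permutes[of n f], of "Suc n"] assms by auto
  then show ?thesis by simp
qed

lemma phi_inj:
  "(\<And>i. i \<in> {1..n} \<Longrightarrow> f i \<in> {1..i}) \<Longrightarrow> (\<And>i. i \<in> {1..n} \<Longrightarrow> g i \<in> {1..i}) \<Longrightarrow>
    phi n f = phi n g \<Longrightarrow> i \<in> {1..n} \<Longrightarrow> f i = g i"
proof (induction n)
  case (Suc n)
  have top: "f (Suc n) = g (Suc n)"
  proof -
    have "phi (Suc n) f (Suc n) = f (Suc n)" "phi (Suc n) g (Suc n) = g (Suc n)"
      by (rule phi_Suc_top, use Suc.prems in simp)+
    then show ?thesis
      using Suc.prems(3) by metis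
  qed
  let ?t = "Transposition.transpose (Suc n) (f (Suc n))"
  have "?t \<circ> phi n f = ?t \<circ> phi n g"
    using Suc.prems(3) top unfolding phi.simps by metis
  then have "?t \<circ> (?t \<circ> phi n f) = ?t \<circ> (?t \<circ> phi n g)"
    by simp
  then have "phi n f = phi n g"
    by (simp add: fun_eq_iff)
  then show ?case
    using Suc top by (cases "i = Suc n") auto
qed simp

theorem phi_bij_betw: "bij_betw (phi n) (subexcedant n) {p. p permutes {1..n}}"
proof -
  have inj: "inj_on (phi n) (subexcedant n)"
  proof (rule inj_onI)
    fix f g assume *: "f \<in> subexcedant n" "g \<in> subexcedant n" "phi n f = phi n g"
    then show "f = g"
      unfolding subexcedant_def
      by (intro PiE_ext[of f _ _ g] phi_inj[of n f g]) (auto dest: PiE_mem)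
  qed
  have sub: "phi n ` subexcedant n \<subseteq> {p. p permutes {1..n}}"
  proof safe
    fix f assume "f \<in> subexcedant n"
    then show "phi n f permutes {1..n}"
      unfolding subexcedant_def by (intro phi_permutes) (auto dest: PiE_mem)
  qed
  have "card (phi n ` subexcedant n) = card (subexcedant n)"
    by (rule card_image[OF inj])
  also have "\<dots> = fact n"
    by (simp add: subexcedant_def card_PiE fact_prod)
  also have "\<dots> = card {p. p permutes {1..n}}"
    by (simp add: card_permutations)
  finally have "phi n ` subexcedant n = {p. p permutes {1..n}}"
    using sub by (intro card_subset_eq finite_permutations) auto
  with inj show ?thesis
    by (simp add: bij_betw_def)
qed

definition f_of_perm :: "nat \<Rightarrow> (nat \<Rightarrow> nat) \<Rightarrow> (nat \<Rightarrow> nat)" where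
  "f_of_perm n p = inv_into (subexcedant n) (phi n) p"

text \<open>\<open>catalan_word n w\<close> concerns the word \<open>w 1 \<dots> w n\<close> of length \<open>n\<close>.\<close>

definition catalan_word :: "nat \<Rightarrow> (nat \<Rightarrow> nat) \<Rightarrow> bool" where
  "catalan_word n w \<longleftrightarrow>
    (n \<ge> 1 \<longrightarrow> w 1 = 1) \<and> (\<forall>i\<in>{2..n}. 1 \<le> w i \<and> w i \<le> w (i - 1) + 1)"

definition mod_alternating :: "nat \<Rightarrow> nat \<Rightarrow> (nat \<Rightarrow> nat) \<Rightarrow> bool" where
  "mod_alternating k n p \<longleftrightarrow> p permutes {1..n} \<and> (\<forall>i\<in>{1..n}. [p i = i] (mod k))"

definition mp_C :: "nat \<Rightarrow> nat \<Rightarrow> nat" where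
  "mp_C n k = card {p. mod_alternating k n p \<and> catalan_word n (f_of_perm n p)}"

definition r :: "nat \<Rightarrow> nat \<Rightarrow> nat" where
  "r k n = (if n = 0 then 1 else mp_C n k)"

end

theory Submission
  imports Defs
begin

text \<open>
  Composing with the transposition \<open>(n f(n))\<close> on the left preserves all residues modulo \<open>k\<close> as soon
  as \<open>f(n) \<equiv> n\<close>, and \<open>\<phi>(f)(n) = f(n)\<close>; so \<open>\<phi>(f)\<close> is mod-\<open>k\<close>-alternating if and only if
  \<open>f(i) \<equiv> i\<close> for all \<open>i\<close>. One therefore counts the Catalan words with \<open>w\<^sub>i \<equiv> i\<close>. Cut such a word of
  length \<open>n + 1\<close> at its last letter \<open>1\<close>, at position \<open>j + 1\<close> (so \<open>k\<close> divides \<open>j\<close>): the prefix of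
  length \<open>j\<close> and the suffix of length \<open>n - j\<close>, lowered by one, are arbitrary words of the same kind.
\<close>

section \<open>Residues of a subexcedant function and of its permutation\<close>

lemma mod_alternating_phi_iff:
  assumes "\<And>i. i \<in> {1..n} \<Longrightarrow> f i \<in> {1..i}"
  shows "mod_alternating k n (phi n f) \<longleftrightarrow> (\<forall>i\<in>{1..n}. [f i = i] (mod k))"
  using assms
proof (induction n)
  case 0
  then show ?case
    by (simp add: mod_alternating_def permutes_def)
next
  case (Suc n)
  let ?t = "Transposition.transpose (Suc n) (f (Suc n))"
  \<comment> \<open>The \<open>permutes\<close> conjunct of \<open>mod_alternating\<close> holds by
    \<open>phi_permutes\<close>, so only the congruences remain.\<close>
  have IH: "(\<forall>i\<in>{1..n}. [phi n f i = i] (mod k)) \<longleftrightarrow> (\<forall>i\<in>{1..n}. [f i = i] (mod k))"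
    using Suc phi_permutes[of n f] by (simp add: mod_alternating_def)
  have top: "phi (Suc n) f (Suc n) = f (Suc n)"
    using Suc.prems by (intro phi_Suc_top) simp
  have shift: "[phi (Suc n) f i = i] (mod k) \<longleftrightarrow> [phi n f i = i] (mod k)"
    if "[f (Suc n) = Suc n] (mod k)" for i
  proof -
    have "[?t x = x] (mod k)" for x
      using that by (auto simp: Transposition.transpose_def intro: cong_sym)
    then show ?thesis
      by (metis comp_apply cong_sym cong_trans phi.simps(2))
  qed
  \<comment> \<open>The index \<open>Suc n\<close> is split off first: on either side it yields the
    congruence of \<open>f (Suc n)\<close> on which \<open>shift\<close> depends.\<close>
  have "(\<forall>i\<in>{1..Suc n}. [phi (Suc n) f i = i] (mod k)) \<longleftrightarrow>
      [f (Suc n) = Suc n] (mod k) \<and> (\<forall>i\<in>{1..n}. [phi (Suc n) f i = i] (mod k))"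
    using top by (simp add: atLeastAtMostSuc_conv del: phi.simps)
  also have "\<dots> \<longleftrightarrow> (\<forall>i\<in>{1..Suc n}. [f i = i] (mod k))"
    using shift IH by (auto simp: atLeastAtMostSuc_conv simp del: phi.simps)
  finally show ?case
    using phi_permutes[of "Suc n" f] Suc.prems by (simp add: mod_alternating_def del: phi.simps)
qed

section \<open>Catalan words with prescribed residues\<close>

lemma catalan_word_iff:
  "catalan_word n w \<longleftrightarrow>
    (1 \<le> n \<longrightarrow> w 1 = 1) \<and> (\<forall>i\<in>{1..n}. 1 \<le> w i) \<and>
    (\<forall>i. 1 \<le> i \<longrightarrow> i < n \<longrightarrow> w (Suc i) \<le> Suc (w i))" (is "_ \<longleftrightarrow> ?R")
proof
  assume L: "catalan_word n w"
  have "1 \<le> w i" if "i \<in> {1..n}" for i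
    using L that by (cases "i = 1") (auto simp: catalan_word_def)
  moreover have "w (Suc i) \<le> Suc (w i)" if "1 \<le> i" "i < n" for i
    using L that unfolding catalan_word_def by (auto dest!: bspec[of _ _ "Suc i"])
  ultimately show ?R
    using L by (auto simp: catalan_word_def)
next
  assume R: ?R
  have "w i \<le> w (i - 1) + 1" if "i \<in> {2..n}" for i
    using R that by (cases i) auto
  with R show "catalan_word n w"
    by (auto simp: catalan_word_def)
qed

text \<open>The letters start at 1 and climb by at most one per step. This places Catalan words in
  the domain on which \<open>phi\<close> is bijective.\<close>

lemma catalan_word_subexcedant:
  assumes "catalan_word n w" "i \<in> {1..n}"
  shows "w i \<in> {1..i}"
proof -
  have "1 \<le> i \<Longrightarrow> i \<le> n \<Longrightarrow> w i \<le> i"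
  proof (induction i rule: dec_induct)
    case (step i)
    then have "w (Suc i) \<le> Suc (w i)"
      using assms(1) by (simp add: catalan_word_iff)
    with step show ?case by simp
  qed (use assms(1) in \<open>auto simp: catalan_word_iff\<close>)
  then show ?thesis
    using assms by (auto simp: catalan_word_iff)
qed

text \<open>Extensionality matches the encoding of \<open>subexcedant\<close>: each word is
  represented by exactly one function, so cardinalities count words.\<close>

definition catalan_mod :: "nat \<Rightarrow> nat \<Rightarrow> (nat \<Rightarrow> nat) set" where
  "catalan_mod k n =
    {w \<in> extensional {1..n}. catalan_word n w \<and> (\<forall>i\<in>{1..n}. [w i = i] (mod k))}"

lemma catalan_mod_subset: "catalan_mod k n \<subseteq> subexcedant n"
  using catalan_word_subexcedant by (auto simp: catalan_mod_def subexcedant_def PiE_def Pi_def)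

lemma finite_catalan_mod: "finite (catalan_mod k n)"
  by (rule finite_subset[OF catalan_mod_subset]) (simp add: subexcedant_def finite_PiE)

text \<open>\<open>phi n\<close> restricts to a bijection from these words onto the counted
  permutations: \<open>f_of_perm\<close> undoes it, and the residue conditions agree by
  \<open>mod_alternating_phi_iff\<close>.\<close>

lemma mp_C_eq_card_catalan_mod: "mp_C n k = card (catalan_mod k n)"
proof -
  have inv: "f_of_perm n (phi n f) = f" if "f \<in> subexcedant n" for f
    using phi_bij_betw[of n] that by (simp add: f_of_perm_def bij_betw_def)
  have alt: "mod_alternating k n (phi n f) \<longleftrightarrow> (\<forall>i\<in>{1..n}. [f i = i] (mod k))"
    if "f \<in> subexcedant n" for f
    using that by (intro mod_alternating_phi_iff) (auto simp: subexcedant_def dest: PiE_mem)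
  have "{p. mod_alternating k n p \<and> catalan_word n (f_of_perm n p)} = phi n ` catalan_mod k n"
  proof (intro equalityI subsetI)
    fix p assume p: "p \<in> {p. mod_alternating k n p \<and> catalan_word n (f_of_perm n p)}"
    then have "p \<in> phi n ` subexcedant n"
      using phi_bij_betw[of n] by (simp add: bij_betw_def mod_alternating_def)
    then obtain f where f: "f \<in> subexcedant n" "p = phi n f"
      by blast
    with p inv alt have "f \<in> catalan_mod k n"
      by (auto simp: catalan_mod_def subexcedant_def PiE_def)
    with f show "p \<in> phi n ` catalan_mod k n"
      by blast
  next
    fix p assume "p \<in> phi n ` catalan_mod k n"
    then obtain f where f: "f \<in> catalan_mod k n" "p = phi n f"
      by blast
    moreover have "f \<in> subexcedant n"
      using f catalan_mod_subset by blast
    ultimately show "p \<in> {p. mod_alternating k n p \<and> catalan_word n (f_of_perm n p)}"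
      using inv alt by (auto simp: catalan_mod_def)
  qed
  moreover have "inj_on (phi n) (catalan_mod k n)"
    using phi_bij_betw[of n] catalan_mod_subset by (metis bij_betw_def inj_on_subset)
  ultimately show ?thesis
    by (simp add: mp_C_def card_image)
qed

text \<open>The convention for length 0 counts the empty word, so the recurrence can be proved for
  cardinalities without a special case.\<close>

lemma r_eq_card_catalan_mod: "r k n = card (catalan_mod k n)"
proof (cases "n = 0")
  case True
  have "catalan_mod k 0 = {\<lambda>_. undefined}"
    by (auto simp: catalan_mod_def catalan_word_def)
  with True show ?thesis
    by (simp add: r_def)
qed (simp add: r_def mp_C_eq_card_catalan_mod)

section \<open>Decomposition at the last letter 1\<close>

definition glue :: "nat \<Rightarrow> nat \<Rightarrow> (nat \<Rightarrow> nat) \<Rightarrow> (nat \<Rightarrow> nat) \<Rightarrow> nat \<Rightarrow> nat" where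
  "glue n j u v = (\<lambda>i\<in>{1..Suc n}.
    if i \<le> j then u i else if i = Suc j then 1 else Suc (v (i - Suc j)))"

text \<open>The letter \<open>v m\<close> moves to position \<open>Suc j + m\<close>. Since
  \<open>k\<close> divides \<open>j\<close>, this changes the residue of its position by 1, and
  raising the letter by one compensates for that.\<close>

lemma glue_in_catalan_mod:
  assumes u: "u \<in> catalan_mod k j" and v: "v \<in> catalan_mod k (n - j)"
    and j: "j \<le> n" "k dvd j"
  shows "glue n j u v \<in> catalan_mod k (Suc n)"
proof -
  have "[glue n j u v i = i] (mod k)" if i: "i \<in> {1..Suc n}" for i
  proof -
    consider "i \<le> j" | "i = Suc j" | "Suc j < i" by linarith
    then show ?thesis
    proof cases
      case 1
      then show ?thesis
        using u i by (simp add: glue_def catalan_mod_def)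
    next
      case 2
      have "[0 + 1 = j + 1] (mod k)"
        using j by (intro cong_add) (auto simp: cong_def)
      with 2 show ?thesis
        using i by (simp add: glue_def)
    next
      case 3
      then obtain m where m: "i = Suc j + m" "1 \<le> m" "m \<le> n - j"
        using i by (intro that[of "i - Suc j"]) auto
      then have "[v m = m] (mod k)"
        using v by (simp add: catalan_mod_def)
      then have "[0 + (v m + 1) = j + (m + 1)] (mod k)"
        using j by (intro cong_add) (auto simp: cong_def)
      with m show ?thesis
        using i by (simp add: glue_def)
    qed
  qed
  moreover have "catalan_word (Suc n) (glue n j u v)"
  proof -
    have "glue n j u v 1 = 1"
      using u by (auto simp: glue_def catalan_mod_def catalan_word_iff)
    moreover have "1 \<le> glue n j u v i" if "i \<in> {1..Suc n}" for i
      using u that by (auto simp: glue_def catalan_mod_def catalan_word_iff)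
    moreover have "glue n j u v (Suc i) \<le> Suc (glue n j u v i)" if i: "1 \<le> i" "i < Suc n" for i
    proof -
      \<comment> \<open>Inside a block the bound is inherited. At the seams, the step from
        \<open>j\<close> lands on 1, and the step from \<open>Suc j\<close> goes from 1 to
        \<open>Suc (v 1)\<close>, which is 2.\<close>
      consider "i < j" | "i = j" | "i = Suc j" | "Suc j < i"
        by linarith
      then show ?thesis
      proof cases
        case 3
        then have "v 1 = 1"
          using v i by (simp add: catalan_mod_def catalan_word_iff)
        with 3 i show ?thesis
          by (simp add: glue_def)
      next
        case 4
        have "v (Suc (i - Suc j)) \<le> Suc (v (i - Suc j))"
          using v 4 i by (simp add: catalan_mod_def catalan_word_iff)
        with 4 i show ?thesis
          by (simp add: glue_def Suc_diff_Suc)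
      qed (use u i in \<open>auto simp: glue_def catalan_mod_def catalan_word_iff\<close>)
    qed
    ultimately show ?thesis
      by (simp add: catalan_word_iff)
  qed
  ultimately show ?thesis
    by (simp add: catalan_mod_def glue_def)
qed

text \<open>Letters beyond \<open>Suc j\<close> are successors of positive letters, hence at least
  2. So \<open>j\<close> can be recovered from the glued word.\<close>

lemma glue_eq_1_le:
  assumes "v \<in> catalan_mod k (n - j)" "glue n j u v i = 1" "i \<in> {1..Suc n}"
  shows "i \<le> Suc j"
proof (rule ccontr)
  assume *: "\<not> i \<le> Suc j"
  then have "i - Suc j \<in> {1..n - j}"
    using assms(3) by auto
  then have "1 \<le> v (i - Suc j)"
    using assms(1) by (auto simp: catalan_mod_def catalan_word_iff)
  with * assms(2,3) show False
    by (simp add: glue_def)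
qed

lemma glue_inject:
  assumes u: "u \<in> catalan_mod k j" "u' \<in> catalan_mod k j'"
    and v: "v \<in> catalan_mod k (n - j)" "v' \<in> catalan_mod k (n - j')"
    and j: "j \<le> n" "j' \<le> n"
    and eq: "glue n j u v = glue n j' u' v'"
  shows "j = j' \<and> u = u' \<and> v = v'"
proof -
  have "glue n j u v (Suc j) = 1" "glue n j' u' v' (Suc j') = 1"
    using j by (simp_all add: glue_def)
  \<comment> \<open>Each separator is a letter 1 of the common word, so neither lies beyond the
    other.\<close>
  then have "Suc j \<le> Suc j'" "Suc j' \<le> Suc j"
    using glue_eq_1_le[OF v(1), of u "Suc j'"] glue_eq_1_le[OF v(2), of u' "Suc j"] j eq
    by auto
  then have jj: "j = j'" by simp
  have "u i = u' i" if "i \<in> {1..j}" for i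
    using fun_cong[OF eq, of i] that j jj by (simp add: glue_def)
  then have "u = u'"
    using u jj by (intro extensionalityI[of u "{1..j}" u']) (auto simp: catalan_mod_def)
  moreover have "v i = v' i" if "i \<in> {1..n - j}" for i
    using fun_cong[OF eq, of "Suc j + i"] that j jj by (auto simp: glue_def split: if_splits)
  then have "v = v'"
    using v jj by (intro extensionalityI[of v "{1..n - j}" v']) (auto simp: catalan_mod_def)
  ultimately show ?thesis
    using jj by simp
qed

lemma catalan_mod_glueE:
  assumes w: "w \<in> catalan_mod k (Suc n)"
  obtains j u v where "j \<le> n" "k dvd j" "u \<in> catalan_mod k j" "v \<in> catalan_mod k (n - j)"
    "w = glue n j u v"
proof -
  have cat: "w 1 = 1" "\<And>i. i \<in> {1..Suc n} \<Longrightarrow> 1 \<le> w i"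
      "\<And>i. 1 \<le> i \<Longrightarrow> i < Suc n \<Longrightarrow> w (Suc i) \<le> Suc (w i)"
    and cong: "\<And>i. i \<in> {1..Suc n} \<Longrightarrow> [w i = i] (mod k)"
    and ext: "w \<in> extensional {1..Suc n}"
    using w by (auto simp: catalan_mod_def catalan_word_iff)
  define S where "S = {i \<in> {1..Suc n}. w i = 1}"
  have S: "finite S" "1 \<in> S"
    using cat by (auto simp: S_def)
  then have "Max S \<in> S"
    by (intro Max_in) auto
  then obtain j where j: "Max S = Suc j" "j \<le> n" "w (Suc j) = 1"
    by (cases "Max S") (simp_all add: S_def)
  \<comment> \<open>By maximality no 1 occurs after \<open>Suc j\<close>; lowering the suffix by one
    therefore keeps its letters positive.\<close>
  have big: "2 \<le> w i" if "i \<in> {Suc (Suc j)..Suc n}" for i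
  proof -
    have "i \<notin> S"
      using Max_ge[OF S(1), of i] j that by auto
    then have "w i \<noteq> 1" "1 \<le> w i"
      using cat(2)[of i] that by (auto simp: S_def)
    then show ?thesis by simp
  qed
  \<comment> \<open>The letter at position \<open>j + 1\<close> is 1, so its residue condition reads
    1 = j + 1 modulo \<open>k\<close>.\<close>
  have dvd: "k dvd j"
  proof -
    have "[0 + 1 = j + 1] (mod k)"
      using cong[of "Suc j"] j by simp
    then have "[0 = j] (mod k)"
      by (simp only: cong_add_rcancel_nat)
    then show ?thesis
      by (simp add: cong_def dvd_eq_mod_eq_0)
  qed
  define u where "u = restrict w {1..j}"
  define v where "v = (\<lambda>i\<in>{1..n - j}. w (Suc j + i) - 1)"
  have "u \<in> catalan_mod k j"
    using cat cong j(2) by (auto simp: u_def catalan_mod_def catalan_word_iff)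
  moreover have "v \<in> catalan_mod k (n - j)"
  proof -
    \<comment> \<open>The letter after the last 1 is at least 2 by \<open>big\<close> and at most 2
      by the Catalan condition.\<close>
    have "v 1 = 1" if "1 \<le> n - j"
    proof -
      have "j < n"
        using that by simp
      then show ?thesis
        using that big[of "Suc (Suc j)"] cat(3)[of "Suc j"] j(3) by (simp add: v_def)
    qed
    moreover have "1 \<le> v i" if "i \<in> {1..n - j}" for i
    proof -
      have "j + i \<le> n"
        using that by auto
      then show ?thesis
        using that big[of "Suc j + i"] by (auto simp: v_def)
    qed
    moreover have "v (Suc i) \<le> Suc (v i)" if "1 \<le> i" "i < n - j" for i
    proof -
      have "j + i < n"
        using that by auto
      then show ?thesis
        using that cat(3)[of "Suc j + i"] by (auto simp: v_def)
    qed
    moreover have "[v i = i] (mod k)" if i: "i \<in> {1..n - j}" for i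
    proof -
      have ji: "j + i \<le> n"
        using i by auto
      \<comment> \<open>By \<open>big\<close> the truncated subtraction in \<open>v\<close> loses
        nothing.\<close>
      then have "w (Suc j + i) = v i + 1"
        using i big[of "Suc j + i"] by (auto simp: v_def)
      then have "[v i + 1 = (j + i) + 1] (mod k)"
        using ji cong[of "Suc j + i"] by auto
      then have "[v i = j + i] (mod k)"
        by (simp only: cong_add_rcancel_nat)
      also have "[j + i = 0 + i] (mod k)"
        using dvd by (intro cong_add) (auto simp: cong_0_iff)
      finally show ?thesis by simp
    qed
    ultimately show ?thesis
      by (simp add: catalan_mod_def catalan_word_iff v_def)
  qed
  moreover have "w = glue n j u v"
  proof (rule extensionalityI[OF ext])
    show "glue n j u v \<in> extensional {1..Suc n}"
      by (simp add: glue_def)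
    fix i assume i: "i \<in> {1..Suc n}"
    consider "i \<le> j" | "i = Suc j" | "Suc j < i" by linarith
    then show "w i = glue n j u v i"
    proof cases
      case 3
      then have "i - Suc j \<in> {1..n - j}"
        using i by auto
      with 3 i big[of i] show ?thesis
        by (simp add: glue_def v_def)
    qed (use i j in \<open>auto simp: glue_def u_def\<close>)
  qed
  ultimately show thesis
    using that j(2) dvd by blast
qed

section \<open>Counting the decompositions\<close>

lemma card_catalan_mod_Suc:
  "card (catalan_mod k (Suc n)) =
    (\<Sum>j | j \<le> n \<and> k dvd j. card (catalan_mod k j) * card (catalan_mod k (n - j)))"
proof -
  let ?J = "{j. j \<le> n \<and> k dvd j}"
  \<comment> \<open>The cut \<open>j\<close> is part of the triple because the sets for
    \<open>u\<close> and \<open>v\<close> depend on it; \<open>glue_inject\<close> also separates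
    different cuts, so the sum is over a disjoint union.\<close>
  let ?T = "Sigma ?J (\<lambda>j. catalan_mod k j \<times> catalan_mod k (n - j))"
  have "bij_betw (\<lambda>(j, u, v). glue n j u v) ?T (catalan_mod k (Suc n))"
    unfolding bij_betw_def
  proof
    show "inj_on (\<lambda>(j, u, v). glue n j u v) ?T"
      by (rule inj_onI) (auto dest: glue_inject)
    show "(\<lambda>(j, u, v). glue n j u v) ` ?T = catalan_mod k (Suc n)"
    proof (intro equalityI subsetI)
      fix w assume "w \<in> catalan_mod k (Suc n)"
      then show "w \<in> (\<lambda>(j, u, v). glue n j u v) ` ?T"
        by (rule catalan_mod_glueE) force
    qed (auto intro: glue_in_catalan_mod)
  qed
  then have "card (catalan_mod k (Suc n)) = card ?T"
    by (rule bij_betw_same_card[symmetric])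
  also have "\<dots> = (\<Sum>j\<in>?J. card (catalan_mod k j \<times> catalan_mod k (n - j)))"
    by (rule card_SigmaI) (auto simp: finite_catalan_mod)
  finally show ?thesis
    by (simp add: card_cartesian_product)
qed

theorem mainTheorem9:
  fixes k n :: nat
  assumes "k \<ge> 1"
  shows "r k (n + 1) = (\<Sum>j | 0 \<le> j \<and> j \<le> n \<and> k dvd j. r k j * r k (n - j))"
  by (simp add: r_eq_card_catalan_mod card_catalan_mod_Suc)

end
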